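(* Let $(U,A^{\psi})$ and $(V,B^{\psi})$ be generalized intuitionistic fuzzy $\psi$-normed linear spaces, let $f$ be a mapping from $(U,A^{\psi})$ to $(V,B^{\psi})$, and let $D$ be a compact subset of $U$. If $f$ is intuitionistic fuzzy continuous on $U$, then $f(D)$ is a compact subset of $V$.
   Context: Write $\mathbf{R}^{+}=(0,\infty)$. A continuous $t$-norm is a continuous, commutative, associative map $\ast:[0,1]\times[0,1]\to[0,1]$ with $a\ast 1=a$ for all $a$, and $a\ast b\le c\ast d$ whenever $a\le c$, $b\le d$. A continuous $t$-conorm is a continuous, commutative, associative map $\diamond:[0,1]\times[0,1]\to[0,1]$ with $a\diamond 0=a$ for all $a$, and $a\diamond b\le c\diamond d$ whenever $a\le c$, $b\le d$. An operation $\circ$ on $\mathbf{R}^{+}$ is a function $\circ:[0,\infty)\times[0,\infty)\to[0,\infty)$ that is associative, commutative, non-decreasing in each place and satisfies $a\circ 0=a$ for all $a\in[0,\infty)$. $\psi:\mathbf{R}\to\mathbf{R}$ is a function with $\psi(-t)=\psi(t)$ for all $t$; $\psi(1)=1$; $\psi$ strictly increasing and continuous on $(0,\infty)$; $\lim_{\alpha\to 0}\psi(\alpha)=0$ and $\lim_{\alpha\to\infty}\psi(\alpha)=\infty$. Fix such $\ast,\diamond,\circ,\psi$. Let $V$ be a linear space over $\mathbf{R}$ with null vector $\theta$. A generalized intuitionistic fuzzy $\psi$-norm on $V$ is an object $A^{\psi}=\{((x,t),\mu(x,t),\nu(x,t)):(x,t)\in V\times\mathbf{R}^{+}\}$, where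 $\mu,\nu:V\times\mathbf{R}^{+}\to[0,1]$ satisfy, for all $x,y\in V$ and $s,t\in\mathbf{R}^{+}$: (i) $\mu(x,t)+\nu(x,t)\le 1$; (ii) $\mu(x,t)>0$; (iii) $\mu(x,t)=1$ if and only if $x=\theta$; (iv) $\mu(\alpha x,t)=\mu(x,t/\psi(\alpha))$ for all $\alpha\in\mathbf{R}$, $\alpha\ne 0$; (v) $\mu(x,s)\ast\mu(y,t)\le\mu(x+y,s\circ t)$; (vi) $\mu(x,\cdot)$ is non-decreasing on $\mathbf{R}^{+}$ and $\lim_{t\to\infty}\mu(x,t)=1$; (vii) $\nu(x,t)<1$; (viii) $\nu(x,t)=0$ if and only if $x=\theta$; (ix) $\nu(\alpha x,t)=\nu(x,t/\psi(\alpha))$ for all $\alpha\in\mathbf{R}$, $\alpha\neq 0$; (x) $\nu(x,s)\diamond\nu(y,t)\ge\nu(x+y,s\circ t)$; (xi) $\nu(x,\cdot)$ is non-increasing on $\mathbf{R}^{+}$ and $\lim_{t\to\infty}\nu(x,t)=0$. The pair $(V,A^{\psi})$ is then called a generalized intuitionistic fuzzy $\psi$-normed linear space. A sequence $\{x_n\}$ in $V$ converges to $x\in V$ if for every $r\in(0,1)$ and $t>0$ there is $n_0\in\mathbf{N}$ such that $\mu(x_n-x,t)>1-r$ and $\nu(x_n-x,t)<r$ for all $n\ge n_0$. A subset $P\subseteq V$ is compact if every sequence in $P$ has a subsequence converging to an element of $P$. For spaces $(U,A^{\psi})$ and $(V,B^{\psi})$, the functions of $A^{\psi}$ are denoted $\mu_U,\nu_U$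 and those of $B^{\psi}$ are denoted $\mu_V,\nu_V$. A mapping $f:U\to V$ is intuitionistic fuzzy continuous at $x_0\in U$ if for every $\varepsilon>0$ and $\alpha\in(0,1)$ there exist $\delta=\delta(\alpha,\varepsilon)>0$ and $\beta=\beta(\alpha,\varepsilon)\in(0,1)$ such that for all $x\in U$: $\mu_U(x-x_0,\delta)>\beta$ implies $\mu_V(f(x)-f(x_0),\varepsilon)>\alpha$, and $\nu_U(x-x_0,\delta)<1-\beta$ implies $\nu_V(f(x)-f(x_0),\varepsilon)<1-\alpha$. It is intuitionistic fuzzy continuous on $U$ if it is so at each point of $U$. *)

theory Defs
  imports "HOL-Analysis.Analysis"
begin

text \<open>Partial functions of the source (operations on \<open>[0,1]\<close> or \<open>[0,\<infinity>)\<close>, membership functions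
  on \<open>V \<times> (0,\<infinity>)\<close>) are total functions on the reals here, constrained only on their intended
  domain; values outside it are irrelevant.\<close>

definition continuous_tnorm :: "(real \<Rightarrow> real \<Rightarrow> real) \<Rightarrow> bool" where
  "continuous_tnorm T \<longleftrightarrow>
     (\<forall>a\<in>{0..1}. \<forall>b\<in>{0..1}. T a b \<in> {0..1}) \<and>
     continuous_on ({0..1} \<times> {0..1}) (\<lambda>(a, b). T a b) \<and>
     (\<forall>a\<in>{0..1}. \<forall>b\<in>{0..1}. T a b = T b a) \<and>
     (\<forall>a\<in>{0..1}. \<forall>b\<in>{0..1}. \<forall>c\<in>{0..1}. T (T a b) c = T a (T b c)) \<and>
     (\<forall>a\<in>{0..1}. T a 1 = a) \<and>
     (\<forall>a\<in>{0..1}. \<forall>b\<in>{0..1}. \<forall>c\<in>{0..1}. \<forall>d\<in>{0..1}. a \<le> c \<longrightarrow> b \<le> d \<longrightarrow> T a b \<le> T c d)"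

definition continuous_tconorm :: "(real \<Rightarrow> real \<Rightarrow> real) \<Rightarrow> bool" where
  "continuous_tconorm S \<longleftrightarrow>
     (\<forall>a\<in>{0..1}. \<forall>b\<in>{0..1}. S a b \<in> {0..1}) \<and>
     continuous_on ({0..1} \<times> {0..1}) (\<lambda>(a, b). S a b) \<and>
     (\<forall>a\<in>{0..1}. \<forall>b\<in>{0..1}. S a b = S b a) \<and>
     (\<forall>a\<in>{0..1}. \<forall>b\<in>{0..1}. \<forall>c\<in>{0..1}. S (S a b) c = S a (S b c)) \<and>
     (\<forall>a\<in>{0..1}. S a 0 = a) \<and>
     (\<forall>a\<in>{0..1}. \<forall>b\<in>{0..1}. \<forall>c\<in>{0..1}. \<forall>d\<in>{0..1}. a \<le> c \<longrightarrow> b \<le> d \<longrightarrow> S a b \<le> S c d)"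

definition pos_operation :: "(real \<Rightarrow> real \<Rightarrow> real) \<Rightarrow> bool" where
  "pos_operation R \<longleftrightarrow>
     (\<forall>a\<ge>0. \<forall>b\<ge>0. R a b \<ge> 0) \<and>
     (\<forall>a\<ge>0. \<forall>b\<ge>0. \<forall>c\<ge>0. R (R a b) c = R a (R b c)) \<and>
     (\<forall>a\<ge>0. \<forall>b\<ge>0. R a b = R b a) \<and>
     (\<forall>a\<ge>0. mono_on {0..} (R a)) \<and>
     (\<forall>b\<ge>0. mono_on {0..} (\<lambda>a. R a b)) \<and>
     (\<forall>a\<ge>0. R a 0 = a)"

definition psi_function :: "(real \<Rightarrow> real) \<Rightarrow> bool" where
  "psi_function \<psi> \<longleftrightarrow>
     (\<forall>t. \<psi> (- t) = \<psi> t) \<and>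
     \<psi> 1 = 1 \<and>
     strict_mono_on {0<..} \<psi> \<and>
     continuous_on {0<..} \<psi> \<and>
     (\<psi> \<longlongrightarrow> 0) (at 0) \<and>
     filterlim \<psi> at_top at_top"

text \<open>The object \<open>A\<^sup>\<psi>\<close> is the joint graph of \<open>\<mu>\<close> and \<open>\<nu>\<close> and is represented by these two
  functions.\<close>

definition gif_psi_norm ::
  "(real \<Rightarrow> real \<Rightarrow> real) \<Rightarrow> (real \<Rightarrow> real \<Rightarrow> real) \<Rightarrow> (real \<Rightarrow> real \<Rightarrow> real) \<Rightarrow> (real \<Rightarrow> real) \<Rightarrow>
   ('v::real_vector \<Rightarrow> real \<Rightarrow> real) \<Rightarrow> ('v \<Rightarrow> real \<Rightarrow> real) \<Rightarrow> bool" where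
  "gif_psi_norm T S R \<psi> \<mu> \<nu> \<longleftrightarrow>
     (\<forall>x. \<forall>t>0. \<mu> x t \<in> {0..1} \<and> \<nu> x t \<in> {0..1}) \<and>
     (\<forall>x. \<forall>t>0. \<mu> x t + \<nu> x t \<le> 1) \<and>
     (\<forall>x. \<forall>t>0. \<mu> x t > 0) \<and>
     (\<forall>x. \<forall>t>0. \<mu> x t = 1 \<longleftrightarrow> x = 0) \<and>
     (\<forall>x. \<forall>t>0. \<forall>\<alpha>. \<alpha> \<noteq> 0 \<longrightarrow> \<mu> (\<alpha> *\<^sub>R x) t = \<mu> x (t / \<psi> \<alpha>)) \<and>
     (\<forall>x y. \<forall>s>0. \<forall>t>0. T (\<mu> x s) (\<mu> y t) \<le> \<mu> (x + y) (R s t)) \<and>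
     (\<forall>x. mono_on {0<..} (\<mu> x) \<and> (\<mu> x \<longlongrightarrow> 1) at_top) \<and>
     (\<forall>x. \<forall>t>0. \<nu> x t < 1) \<and>
     (\<forall>x. \<forall>t>0. \<nu> x t = 0 \<longleftrightarrow> x = 0) \<and>
     (\<forall>x. \<forall>t>0. \<forall>\<alpha>. \<alpha> \<noteq> 0 \<longrightarrow> \<nu> (\<alpha> *\<^sub>R x) t = \<nu> x (t / \<psi> \<alpha>)) \<and>
     (\<forall>x y. \<forall>s>0. \<forall>t>0. S (\<nu> x s) (\<nu> y t) \<ge> \<nu> (x + y) (R s t)) \<and>
     (\<forall>x. antimono_on {0<..} (\<nu> x) \<and> (\<nu> x \<longlongrightarrow> 0) at_top)"

definition gif_converges ::
  "('v::real_vector \<Rightarrow> real \<Rightarrow> real) \<Rightarrow> ('v \<Rightarrow> real \<Rightarrow> real) \<Rightarrow> (nat \<Rightarrow> 'v) \<Rightarrow> 'v \<Rightarrow> bool" where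
  "gif_converges \<mu> \<nu> X x \<longleftrightarrow>
     (\<forall>r\<in>{0<..<1}. \<forall>t>0. \<exists>n0. \<forall>n\<ge>n0. \<mu> (X n - x) t > 1 - r \<and> \<nu> (X n - x) t < r)"

definition gif_compact ::
  "('v::real_vector \<Rightarrow> real \<Rightarrow> real) \<Rightarrow> ('v \<Rightarrow> real \<Rightarrow> real) \<Rightarrow> 'v set \<Rightarrow> bool" where
  "gif_compact \<mu> \<nu> P \<longleftrightarrow>
     (\<forall>X. (\<forall>n. X n \<in> P) \<longrightarrow>
        (\<exists>x\<in>P. \<exists>k :: nat \<Rightarrow> nat. strict_mono k \<and> gif_converges \<mu> \<nu> (X \<circ> k) x))"

definition if_continuous_at ::
  "('u::real_vector \<Rightarrow> real \<Rightarrow> real) \<Rightarrow> ('u \<Rightarrow> real \<Rightarrow> real) \<Rightarrow>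
   ('v::real_vector \<Rightarrow> real \<Rightarrow> real) \<Rightarrow> ('v \<Rightarrow> real \<Rightarrow> real) \<Rightarrow> ('u \<Rightarrow> 'v) \<Rightarrow> 'u \<Rightarrow> bool" where
  "if_continuous_at \<mu>U \<nu>U \<mu>V \<nu>V f x0 \<longleftrightarrow>
     (\<forall>\<epsilon>>0. \<forall>\<alpha>\<in>{0<..<1}. \<exists>\<delta>>0. \<exists>\<beta>\<in>{0<..<1}. \<forall>x.
        (\<mu>U (x - x0) \<delta> > \<beta> \<longrightarrow> \<mu>V (f x - f x0) \<epsilon> > \<alpha>) \<and>
        (\<nu>U (x - x0) \<delta> < 1 - \<beta> \<longrightarrow> \<nu>V (f x - f x0) \<epsilon> < 1 - \<alpha>))"

definition if_continuous ::
  "('u::real_vector \<Rightarrow> real \<Rightarrow> real) \<Rightarrow> ('u \<Rightarrow> real \<Rightarrow> real) \<Rightarrow>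
   ('v::real_vector \<Rightarrow> real \<Rightarrow> real) \<Rightarrow> ('v \<Rightarrow> real \<Rightarrow> real) \<Rightarrow> ('u \<Rightarrow> 'v) \<Rightarrow> bool" where
  "if_continuous \<mu>U \<nu>U \<mu>V \<nu>V f \<longleftrightarrow> (\<forall>x0. if_continuous_at \<mu>U \<nu>U \<mu>V \<nu>V f x0)"

end

theory Submission
  imports Defs
begin

text \<open>The argument is the metric one: pull a sequence of the image back to \<open>D\<close>, extract a convergent
  subsequence there, and push its limit forward by \<open>f\<close>. Continuity at the limit point suffices for
  the last step: its pairs \<open>(\<epsilon>, \<alpha>)\<close> and \<open>(\<delta>, \<beta>)\<close> describe the same kind of neighbourhood as the
  pair \<open>(t, r)\<close> in the definition of convergence, with \<open>\<epsilon>\<close> or \<open>\<delta>\<close> as \<open>t\<close> and \<open>1 - \<alpha>\<close> or \<open>1 - \<beta>\<close>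
  as \<open>r\<close>.\<close>

lemma gif_converges_image:
  assumes cont: "if_continuous_at \<mu>U \<nu>U \<mu>V \<nu>V f x"
    and conv: "gif_converges \<mu>U \<nu>U X x"
  shows "gif_converges \<mu>V \<nu>V (f \<circ> X) (f x)"
  unfolding gif_converges_def
proof (intro ballI allI impI)
  fix r t :: real
  assume r: "r \<in> {0<..<1}" and t: "t > 0"
  have "1 - r \<in> {0<..<1}" using r by simp
  with cont t have "\<exists>\<delta>>0. \<exists>\<beta>\<in>{0<..<1}. \<forall>y.
      (\<mu>U (y - x) \<delta> > \<beta> \<longrightarrow> \<mu>V (f y - f x) t > 1 - r) \<and>
      (\<nu>U (y - x) \<delta> < 1 - \<beta> \<longrightarrow> \<nu>V (f y - f x) t < 1 - (1 - r))"
    unfolding if_continuous_at_def by blast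
  then obtain \<delta> \<beta> where \<delta>: "\<delta> > 0" and \<beta>: "\<beta> \<in> {0<..<1}"
    and \<mu>: "\<And>y. \<mu>U (y - x) \<delta> > \<beta> \<Longrightarrow> \<mu>V (f y - f x) t > 1 - r"
    and \<nu>: "\<And>y. \<nu>U (y - x) \<delta> < 1 - \<beta> \<Longrightarrow> \<nu>V (f y - f x) t < 1 - (1 - r)"
    by blast
  have "1 - \<beta> \<in> {0<..<1}" using \<beta> by simp
  then obtain n0 where "\<forall>n\<ge>n0. \<mu>U (X n - x) \<delta> > 1 - (1 - \<beta>) \<and> \<nu>U (X n - x) \<delta> < 1 - \<beta>"
    using conv \<delta> unfolding gif_converges_def by blast
  then have "\<forall>n\<ge>n0. \<mu>V ((f \<circ> X) n - f x) t > 1 - r \<and> \<nu>V ((f \<circ> X) n - f x) t < r"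
    using \<mu> \<nu> by simp
  then show "\<exists>n0. \<forall>n\<ge>n0. \<mu>V ((f \<circ> X) n - f x) t > 1 - r \<and> \<nu>V ((f \<circ> X) n - f x) t < r" ..
qed

theorem theorem5p6:
  fixes T S R :: "real \<Rightarrow> real \<Rightarrow> real"
    and \<psi> :: "real \<Rightarrow> real"
    and \<mu>U \<nu>U :: "'u::real_vector \<Rightarrow> real \<Rightarrow> real"
    and \<mu>V \<nu>V :: "'v::real_vector \<Rightarrow> real \<Rightarrow> real"
    and f :: "'u \<Rightarrow> 'v"
    and D :: "'u set"
  assumes "continuous_tnorm T" and "continuous_tconorm S"
    and "pos_operation R" and "psi_function \<psi>"
    and "gif_psi_norm T S R \<psi> \<mu>U \<nu>U"
    and "gif_psi_norm T S R \<psi> \<mu>V \<nu>V"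
    and "gif_compact \<mu>U \<nu>U D"
    and "if_continuous \<mu>U \<nu>U \<mu>V \<nu>V f"
  shows "gif_compact \<mu>V \<nu>V (f ` D)"
  unfolding gif_compact_def
proof (intro allI impI)
  fix Y :: "nat \<Rightarrow> 'v"
  assume "\<forall>n. Y n \<in> f ` D"
  then have "\<forall>n. \<exists>x. x \<in> D \<and> Y n = f x" by blast
  then obtain X where X: "\<And>n. X n \<in> D" and Y: "\<And>n. Y n = f (X n)" by metis
  from X obtain x k where x: "x \<in> D" and k: "strict_mono (k :: nat \<Rightarrow> nat)"
    and conv: "gif_converges \<mu>U \<nu>U (X \<circ> k) x"
    using assms(7) unfolding gif_compact_def by blast
  have "if_continuous_at \<mu>U \<nu>U \<mu>V \<nu>V f x"
    using assms(8) unfolding if_continuous_def by blast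
  then have "gif_converges \<mu>V \<nu>V (f \<circ> (X \<circ> k)) (f x)"
    using conv by (rule gif_converges_image)
  moreover have "f \<circ> (X \<circ> k) = Y \<circ> k" by (simp add: fun_eq_iff Y)
  ultimately have "gif_converges \<mu>V \<nu>V (Y \<circ> k) (f x)" by simp
  then show "\<exists>y\<in>f ` D. \<exists>k. strict_mono k \<and> gif_converges \<mu>V \<nu>V (Y \<circ> k) y"
    using x k by blast
qed

end
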